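(* Let $w$ be a group word. Each of the following seven subspaces is a $G_\delta$ subset of the space $\mathcal{G}$ of enumerated groups, and hence is Polish in the subspace topology: (a) $\mathcal{G}_{\mathrm{sm}}$, the enumerated groups not containing $\mathbf{F}_2$ subgroups; (b) $\mathcal{G}_{\mathrm{am}}$, the amenable enumerated groups; (c) $\mathcal{G}_{\mathrm{ll}}$, the lawless enumerated groups; (d) $\mathcal{G}_{\mathrm{sm},\mathrm{ll}}=\mathcal{G}_{\mathrm{sm}}\cap\mathcal{G}_{\mathrm{ll}}$; (e) $\mathcal{G}_{\mathrm{am},\mathrm{ll}}=\mathcal{G}_{\mathrm{am}}\cap\mathcal{G}_{\mathrm{ll}}$; (f) $\mathcal{G}_w$, the enumerated groups obeying the law $w=e$; (g) $\mathcal{G}_{\mathrm{am},w}=\mathcal{G}_{\mathrm{am}}\cap\mathcal{G}_w$. Moreover, $\mathcal{G}_w$ is closed in $\mathcal{G}$.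
   Context: An enumerated group is a group whose underlying set is $\mathbf{N}=\{1,2,3,\ldots\}$. The set $\mathcal{G}$ of enumerated groups is identified, via (multiplication, inversion, identity), with a subset of $\mathbf{N}^{\mathbf{N}\times\mathbf{N}}\times\mathbf{N}^{\mathbf{N}}\times\mathbf{N}$ (product topology, $\mathbf{N}$ discrete) and given the subspace topology; it is a Polish space. $\mathbf{F}_2$ is the free group of rank 2. A group obeys the law $w=e$ if $w(\vec a)=e$ for all tuples $\vec a$ from the group; it is lawless if it obeys no law $w=e$ with $w$ a nontrivial freely reduced word. *)

theory Defs
  imports "HOL-Analysis.Analysis" "HOL-Algebra.Coset"
begin

section \<open>Group words\<close>

text \<open>The letter \<open>(x, True)\<close> stands for the variable \<open>x\<close> and \<open>(x, False)\<close> for its formal inverse.\<close>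

type_synonym 'x letter = "'x \<times> bool"
type_synonym 'x group_word = "'x letter list"

definition inverse_letters :: "'x letter \<Rightarrow> 'x letter \<Rightarrow> bool" where
  "inverse_letters a b \<longleftrightarrow> fst a = fst b \<and> snd a \<noteq> snd b"

definition freely_reduced :: "'x group_word \<Rightarrow> bool" where
  "freely_reduced w \<longleftrightarrow> successively (\<lambda>a b. \<not> inverse_letters a b) w"

fun letter_value :: "('g, 'm) monoid_scheme \<Rightarrow> ('x \<Rightarrow> 'g) \<Rightarrow> 'x letter \<Rightarrow> 'g" where
  "letter_value G a (x, b) = (if b then a x else inv\<^bsub>G\<^esub> (a x))"

definition word_value :: "('g, 'm) monoid_scheme \<Rightarrow> ('x \<Rightarrow> 'g) \<Rightarrow> 'x group_word \<Rightarrow> 'g" where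
  "word_value G a w = foldr (\<lambda>l g. letter_value G a l \<otimes>\<^bsub>G\<^esub> g) w \<one>\<^bsub>G\<^esub>"

definition obeys_law :: "('g, 'm) monoid_scheme \<Rightarrow> 'x group_word \<Rightarrow> bool" where
  "obeys_law G w \<longleftrightarrow> (\<forall>a. (\<forall>x. a x \<in> carrier G) \<longrightarrow> word_value G a w = \<one>\<^bsub>G\<^esub>)"

definition lawless :: "('g, 'm) monoid_scheme \<Rightarrow> bool" where
  "lawless G \<longleftrightarrow> \<not> (\<exists>w :: nat group_word. freely_reduced w \<and> w \<noteq> [] \<and> obeys_law G w)"

section \<open>Free groups\<close>

fun cons_reduce :: "'x letter \<Rightarrow> 'x group_word \<Rightarrow> 'x group_word" where
  "cons_reduce a [] = [a]"
| "cons_reduce a (b # w) = (if inverse_letters a b then w else a # b # w)"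

definition reduce_word :: "'x group_word \<Rightarrow> 'x group_word" where
  "reduce_word w = foldr cons_reduce w []"

definition free_group :: "'x set \<Rightarrow> 'x group_word monoid" where
  "free_group X = \<lparr>carrier = {w. freely_reduced w \<and> fst ` set w \<subseteq> X},
                   mult = (\<lambda>u v. reduce_word (u @ v)), one = []\<rparr>"

definition contains_F2 :: "('g, 'm) monoid_scheme \<Rightarrow> bool" where
  "contains_F2 G \<longleftrightarrow> (\<exists>H. subgroup H G \<and> G\<lparr>carrier := H\<rparr> \<cong> free_group {0, 1 :: nat})"

section \<open>Amenability of discrete groups\<close>

text \<open>Existence of a left-invariant finitely additive probability measure on all subsets.\<close>

definition amenable :: "('g, 'm) monoid_scheme \<Rightarrow> bool" where
  "amenable G \<longleftrightarrow>
     (\<exists>\<mu> :: 'g set \<Rightarrow> real.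
        \<mu> (carrier G) = 1 \<and>
        (\<forall>A. A \<subseteq> carrier G \<longrightarrow> 0 \<le> \<mu> A) \<and>
        (\<forall>A B. A \<subseteq> carrier G \<longrightarrow> B \<subseteq> carrier G \<longrightarrow> A \<inter> B = {} \<longrightarrow> \<mu> (A \<union> B) = \<mu> A + \<mu> B) \<and>
        (\<forall>g A. g \<in> carrier G \<longrightarrow> A \<subseteq> carrier G \<longrightarrow> \<mu> (g <#\<^bsub>G\<^esub> A) = \<mu> A))"

section \<open>The space of enumerated groups\<close>

text \<open>The underlying set is \<open>{1, 2, 3, \<dots>}\<close>, so the function spaces below consist of functions
  that are extensional (\<open>undefined\<close> off their index set).\<close>

abbreviation Npos :: "nat set" where
  "Npos \<equiv> {1..}"

type_synonym enum_structure = "(nat \<times> nat \<Rightarrow> nat) \<times> (nat \<Rightarrow> nat) \<times> nat"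

definition structure_space :: "enum_structure topology" where
  "structure_space =
     prod_topology (product_topology (\<lambda>_. discrete_topology Npos) (Npos \<times> Npos))
       (prod_topology (product_topology (\<lambda>_. discrete_topology Npos) Npos)
         (discrete_topology Npos))"

fun group_of :: "enum_structure \<Rightarrow> nat monoid" where
  "group_of (m, i, e) = \<lparr>carrier = Npos, mult = (\<lambda>x y. m (x, y)), one = e\<rparr>"

definition enumerated_groups :: "enum_structure set" where
  "enumerated_groups =
     {(m, i, e). (m, i, e) \<in> topspace structure_space \<and> group (group_of (m, i, e)) \<and>
        (\<forall>x\<in>Npos. i x = inv\<^bsub>group_of (m, i, e)\<^esub> x)}"

definition enum_group_space :: "enum_structure topology" where
  "enum_group_space = subtopology structure_space enumerated_groups"

definition polish :: "'a topology \<Rightarrow> bool" where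
  "polish X \<longleftrightarrow> separable_space X \<and> completely_metrizable_space X"

definition G_sm :: "enum_structure set" where
  "G_sm = {p \<in> enumerated_groups. \<not> contains_F2 (group_of p)}"

definition G_am :: "enum_structure set" where
  "G_am = {p \<in> enumerated_groups. amenable (group_of p)}"

definition G_ll :: "enum_structure set" where
  "G_ll = {p \<in> enumerated_groups. lawless (group_of p)}"

definition G_law :: "nat group_word \<Rightarrow> enum_structure set" where
  "G_law w = {p \<in> enumerated_groups. obeys_law (group_of p) w}"

end

theory Submission
  imports Defs
begin

text \<open>
  The space of enumerated groups is closed in a countable product of countable discrete spaces,
  hence second countable and completely metrizable; every \<open>G\<^sub>\<delta>\<close> subset of such a space
  is Polish.  What remains is to describe the properties in question by the right quantifiers over
  finitary data.  For fixed arguments, the value of a word and the product of two finite sets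
  are computed, in each group, from finitely many entries of its tables, so they are locally
  constant and any condition on them is clopen.  A property of the form ``for all (countably many) there exists
  (arbitrarily many) a clopen condition'' is then \<open>G\<^sub>\<delta>\<close>.

  Obeying a law is an intersection of clopen conditions, hence closed.  Being lawless is
  the failure of each of countably many such closed conditions.  Having no free subgroup of rank 2 means
  that every pair of elements satisfies some nontrivial relation (\<open>contains_F2_iff\<close>).

  Amenability, defined by an invariant mean on all subsets, needs a finitary reformulation of
  Folner type (\<open>amenable_iff_small_doubling\<close>): for every finite \<open>S\<close> there is a finite nonempty \<open>F\<close>
  with \<open>|S F| < 2 |F|\<close>.  If this fails for some \<open>S\<close>, then Hall's marriage theorem for infinite
  families (\<open>infinite_marriage\<close>) produces a paradoxical decomposition, which excludes an
  invariant mean.  If it holds, replacing \<open>S\<close> by its powers improves the constant 2 to any constant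
  above 1, and a cluster point of the normalised counting measures of the resulting Folner
  sets is an invariant mean.
\<close>

text \<open>The ASCII notation for multiset inclusion clashes with that for left cosets.\<close>

no_notation subset_mset (infix "<#" 50)

section \<open>Second countability and Polish subspaces\<close>

text \<open>Separability does not pass to subspaces but second countability does, so the separability half
  of Polishness is obtained from second countability of the ambient product.\<close>

lemma second_countable_prod_topology:
  assumes "second_countable X" "second_countable Y"
  shows "second_countable (prod_topology X Y)"
proof -
  obtain \<A> where A: "countable \<A>" "\<And>V. V \<in> \<A> \<Longrightarrow> openin X V"
    "\<And>U x. openin X U \<Longrightarrow> x \<in> U \<Longrightarrow> \<exists>V\<in>\<A>. x \<in> V \<and> V \<subseteq> U"
    using assms(1) unfolding second_countable_def by metis
  obtain \<B> where B: "countable \<B>" "\<And>V. V \<in> \<B> \<Longrightarrow> openin Y V"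
    "\<And>U x. openin Y U \<Longrightarrow> x \<in> U \<Longrightarrow> \<exists>V\<in>\<B>. x \<in> V \<and> V \<subseteq> U"
    using assms(2) unfolding second_countable_def by metis
  let ?C = "(\<lambda>(U, V). U \<times> V) ` (\<A> \<times> \<B>)"
  show ?thesis
    unfolding second_countable_def
  proof (intro exI[of _ ?C] conjI allI impI ballI)
    show "countable ?C" using A(1) B(1) by blast
    show "openin (prod_topology X Y) V" if "V \<in> ?C" for V
      using that A(2) B(2) by (auto simp: openin_prod_Times_iff)
    fix U z assume "openin (prod_topology X Y) U \<and> z \<in> U"
    then obtain P Q where "openin X P" "openin Y Q" "fst z \<in> P" "snd z \<in> Q" "P \<times> Q \<subseteq> U"
      unfolding openin_prod_topology_alt by (metis prod.collapse)
    moreover obtain V W where "V \<in> \<A>" "fst z \<in> V" "V \<subseteq> P" "W \<in> \<B>" "snd z \<in> W" "W \<subseteq> Q"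
      using A(3) B(3) calculation by metis
    ultimately show "\<exists>V\<in>?C. z \<in> V \<and> V \<subseteq> U"
      by (intro bexI[of _ "V \<times> W"]) (auto simp: mem_Times_iff)
  qed
qed

text \<open>A basic open set restricts only finitely many coordinates, and each restriction can be shrunk to
  a member of a countable base.  The cylinders are therefore indexed by the finite subsets of the
  countable set of pairs (coordinate, base member).\<close>

lemma second_countable_product_topology:
  assumes "countable I" and "\<And>i. i \<in> I \<Longrightarrow> second_countable (X i)"
  shows "second_countable (product_topology X I)"
proof -
  have "\<forall>i\<in>I. \<exists>\<B>. countable \<B> \<and> (\<forall>V\<in>\<B>. openin (X i) V) \<and>
      (\<forall>U x. openin (X i) U \<and> x \<in> U \<longrightarrow> (\<exists>V\<in>\<B>. x \<in> V \<and> V \<subseteq> U))"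
    using assms(2) unfolding second_countable_def by blast
  then obtain B where cB: "\<And>i. i \<in> I \<Longrightarrow> countable (B i)"
    and oB: "\<And>i V. i \<in> I \<Longrightarrow> V \<in> B i \<Longrightarrow> openin (X i) V"
    and bB: "\<And>i U x. i \<in> I \<Longrightarrow> openin (X i) U \<Longrightarrow> x \<in> U \<Longrightarrow> \<exists>V\<in>B i. x \<in> V \<and> V \<subseteq> U"
    by metis
  define cyl where "cyl T = {f \<in> topspace (product_topology X I). \<forall>(i, V)\<in>T. f i \<in> V}" for T
  let ?C = "cyl ` {T. T \<subseteq> Sigma I B \<and> finite T}"
  show ?thesis
    unfolding second_countable_def
  proof (intro exI[of _ ?C] conjI allI impI ballI)
    have "countable {T. T \<subseteq> Sigma I B \<and> finite T}"
      using countable_Collect_finite_subset[of "Sigma I B"] assms(1) cB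
      by (simp add: conj_commute)
    then show "countable ?C" by blast
    show "openin (product_topology X I) W" if W: "W \<in> ?C" for W
    proof -
      obtain T where T: "finite T" "T \<subseteq> Sigma I B" and W: "W = cyl T"
        using W by auto
      have o: "openin (product_topology X I) {f \<in> topspace (product_topology X I). f i \<in> V}"
        if "(i, V) \<in> T" for i V
        using that T oB by (intro openin_continuous_map_preimage[OF continuous_map_product_projection]) auto
      show ?thesis
      proof (cases "T = {}")
        case True
        then have "W = topspace (product_topology X I)" using W cyl_def by auto
        then show ?thesis by (simp only: openin_topspace)
      next
        case False
        then have "W = (\<Inter>(i, V)\<in>T. {f \<in> topspace (product_topology X I). f i \<in> V})"
          unfolding W cyl_def by auto
        then show ?thesis using False T o by auto
      qed
    qed
    fix U x assume "openin (product_topology X I) U \<and> x \<in> U"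
    then obtain O' where fin: "finite {i \<in> I. O' i \<noteq> topspace (X i)}"
      and op: "\<And>i. i \<in> I \<Longrightarrow> openin (X i) (O' i)" and x: "x \<in> PiE I O'" and sub: "PiE I O' \<subseteq> U"
      unfolding openin_product_topology_alt by metis
    define J where "J = {i \<in> I. O' i \<noteq> topspace (X i)}"
    have "\<forall>i\<in>I. \<exists>V\<in>B i. x i \<in> V \<and> V \<subseteq> O' i"
      using bB op x by (meson PiE_mem)
    then obtain V where V: "\<And>i. i \<in> I \<Longrightarrow> V i \<in> B i \<and> x i \<in> V i \<and> V i \<subseteq> O' i"
      by metis
    let ?T = "(\<lambda>i. (i, V i)) ` J"
    have "x \<in> topspace (product_topology X I)"
      using x op openin_subset by (fastforce simp: PiE_iff)
    then have "x \<in> cyl ?T" using V J_def by (auto simp: cyl_def)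
    moreover have "cyl ?T \<subseteq> PiE I O'"
    proof
      fix f assume f: "f \<in> cyl ?T"
      have "f i \<in> O' i" if "i \<in> I" for i
      proof (cases "i \<in> J")
        case True then show ?thesis using f V that by (auto simp: cyl_def)
      next
        case False then show ?thesis using f that J_def by (auto simp: cyl_def)
      qed
      then show "f \<in> PiE I O'" using f by (auto simp: cyl_def PiE_iff)
    qed
    moreover have "?T \<in> {T. T \<subseteq> Sigma I B \<and> finite T}"
      using fin V J_def by auto
    ultimately show "\<exists>V\<in>?C. x \<in> V \<and> V \<subseteq> U"
      using sub by (intro bexI[of _ "cyl ?T"] conjI imageI) auto
  qed
qed

lemma polish_gdelta_in:
  assumes "completely_metrizable_space X" "second_countable X" "gdelta_in X S"
  shows "polish (subtopology X S)"
  unfolding polish_def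
  using assms completely_metrizable_space_gdelta_in second_countable_subtopology
    second_countable_imp_separable_space by blast

section \<open>Locally constant functions\<close>

text \<open>Equivalently, \<open>f\<close> is continuous for the discrete topology on its codomain.  Every quantity read
  off from finitely many entries of the multiplication and inversion tables has this property,
  and any condition on such a quantity cuts out a clopen set.\<close>

definition locally_constant :: "'a topology \<Rightarrow> ('a \<Rightarrow> 'b) \<Rightarrow> bool" where
  "locally_constant X f \<longleftrightarrow>
     (\<forall>x\<in>topspace X. \<exists>U c. openin X U \<and> x \<in> U \<and> (\<forall>y\<in>U. f y = c))"

lemma locally_constantE:
  assumes "locally_constant X f" "x \<in> topspace X"
  obtains U c where "openin X U" "x \<in> U" "\<And>y. y \<in> U \<Longrightarrow> f y = c"
proof -
  have "\<exists>U c. openin X U \<and> x \<in> U \<and> (\<forall>y\<in>U. f y = c)"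
    using assms unfolding locally_constant_def by simp
  then show thesis using that by (elim exE conjE) simp
qed

lemma locally_constant_const: "locally_constant X (\<lambda>_. c)"
  unfolding locally_constant_def by (intro ballI exI[of _ "topspace X"] exI[of _ c]) auto

lemma locally_constant_compose2:
  assumes "locally_constant X f" "locally_constant X g"
  shows "locally_constant X (\<lambda>x. h (f x) (g x))"
  unfolding locally_constant_def
proof
  fix x assume x: "x \<in> topspace X"
  obtain U c where "openin X U" "x \<in> U" "\<And>y. y \<in> U \<Longrightarrow> f y = c"
    using assms(1) x by (rule locally_constantE) blast
  moreover obtain V d where "openin X V" "x \<in> V" "\<And>y. y \<in> V \<Longrightarrow> g y = d"
    using assms(2) x by (rule locally_constantE) blast
  ultimately show "\<exists>W e. openin X W \<and> x \<in> W \<and> (\<forall>y\<in>W. h (f y) (g y) = e)"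
    by (intro exI[of _ "U \<inter> V"] exI[of _ "h c d"]) auto
qed

text \<open>The coordinate that is looked up may itself vary with the point, as in \<open>x (y z)\<close>, where the
  second lookup depends on the outcome of the first one.\<close>

lemma locally_constant_diagonal:
  assumes "locally_constant X k" "\<And>c. c \<in> k ` topspace X \<Longrightarrow> locally_constant X (\<lambda>x. F x c)"
  shows "locally_constant X (\<lambda>x. F x (k x))"
  unfolding locally_constant_def
proof
  fix x assume x: "x \<in> topspace X"
  obtain U c where U: "openin X U" "x \<in> U" "\<And>y. y \<in> U \<Longrightarrow> k y = c"
    using assms(1) x by (rule locally_constantE) blast
  then have "c \<in> k ` topspace X" using x by blast
  then obtain V d where "openin X V" "x \<in> V" "\<And>y. y \<in> V \<Longrightarrow> F y c = d"
    using locally_constantE[OF assms(2) x] by blast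
  then show "\<exists>W e. openin X W \<and> x \<in> W \<and> (\<forall>y\<in>W. F y (k y) = e)"
    using U by (intro exI[of _ "U \<inter> V"] exI[of _ d]) auto
qed

lemma locally_constant_image:
  assumes "finite A" "\<And>a. a \<in> A \<Longrightarrow> locally_constant X (\<lambda>x. F x a)"
  shows "locally_constant X (\<lambda>x. F x ` A)"
  using assms
proof (induction A rule: finite_induct)
  case empty then show ?case by (simp add: locally_constant_const)
next
  case (insert a A)
  then show ?case
    using locally_constant_compose2[of X "\<lambda>x. F x a" "\<lambda>x. F x ` A" "insert"] by simp
qed

lemma locally_constant_continuous:
  assumes "continuous_map X (discrete_topology D) f"
  shows "locally_constant X f"
  unfolding locally_constant_def
proof
  fix x assume x: "x \<in> topspace X"
  define U where "U = {y \<in> topspace X. f y \<in> {f x}}"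
  have "f x \<in> D" using assms x by (auto simp: continuous_map_def)
  then have "openin X U"
    unfolding U_def by (intro openin_continuous_map_preimage[OF assms]) simp
  moreover have "x \<in> U" "\<forall>y\<in>U. f y = f x" using x by (simp_all add: U_def)
  ultimately show "\<exists>U c. openin X U \<and> x \<in> U \<and> (\<forall>y\<in>U. f y = c)" by blast
qed

lemma locally_constant_subtopology:
  assumes "locally_constant X f"
  shows "locally_constant (subtopology X S) f"
  unfolding locally_constant_def
proof
  fix x assume x: "x \<in> topspace (subtopology X S)"
  then have "x \<in> topspace X" by simp
  with assms obtain U c where "openin X U" "x \<in> U" "\<And>y. y \<in> U \<Longrightarrow> f y = c"
    by (rule locally_constantE) blast
  then show "\<exists>U c. openin (subtopology X S) U \<and> x \<in> U \<and> (\<forall>y\<in>U. f y = c)"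
    using x by (intro exI[of _ "S \<inter> U"] exI[of _ c]) (auto intro: openin_subtopology_Int2)
qed

lemma openin_Collect_locally_constant:
  assumes "locally_constant X f"
  shows "openin X {x \<in> topspace X. P (f x)}"
proof (subst openin_subopen, intro ballI)
  fix x assume x: "x \<in> {x \<in> topspace X. P (f x)}"
  then have "x \<in> topspace X" by simp
  with assms obtain U c where "openin X U" "x \<in> U" "\<And>y. y \<in> U \<Longrightarrow> f y = c"
    by (rule locally_constantE) blast
  moreover from this have "U \<subseteq> {x \<in> topspace X. P (f x)}"
    using x openin_subset[of X U] by auto
  ultimately show "\<exists>T. openin X T \<and> x \<in> T \<and> T \<subseteq> {x \<in> topspace X. P (f x)}"
    by blast
qed

lemma closedin_Collect_locally_constant:
  assumes "locally_constant X f"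
  shows "closedin X {x \<in> topspace X. P (f x)}"
proof -
  have "topspace X - {x \<in> topspace X. P (f x)} = {x \<in> topspace X. \<not> P (f x)}"
    by auto
  then show ?thesis
    using openin_Collect_locally_constant[OF assms, of "\<lambda>y. \<not> P y"]
    by (simp add: closedin_def)
qed

lemma closedin_Collect_Ball:
  assumes "\<And>a. a \<in> A \<Longrightarrow> closedin X {x \<in> topspace X. P x a}"
  shows "closedin X {x \<in> topspace X. \<forall>a\<in>A. P x a}"
proof (cases "A = {}")
  case False
  then have "{x \<in> topspace X. \<forall>a\<in>A. P x a} = (\<Inter>a\<in>A. {x \<in> topspace X. P x a})"
    by auto
  then show ?thesis using assms False by (simp only:) (rule closedin_INT)
qed simp

lemma closedin_Collect_conj:
  assumes "closedin X {x \<in> topspace X. P x}" "closedin X {x \<in> topspace X. Q x}"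
  shows "closedin X {x \<in> topspace X. P x \<and> Q x}"
proof -
  have "{x \<in> topspace X. P x \<and> Q x} = {x \<in> topspace X. P x} \<inter> {x \<in> topspace X. Q x}"
    by auto
  then show ?thesis using assms by (simp only: closedin_Int)
qed

lemma closedin_Collect_eq_locally_constant:
  assumes "locally_constant X f" "locally_constant X g"
  shows "closedin X {x \<in> topspace X. f x = g x}"
  using closedin_Collect_locally_constant[OF locally_constant_compose2[OF assms, of "(=)"], of "\<lambda>b. b"]
  by simp

lemma locally_constant_cong:
  assumes "\<And>x. x \<in> topspace X \<Longrightarrow> f x = g x" "locally_constant X f"
  shows "locally_constant X g"
  unfolding locally_constant_def
proof
  fix x assume "x \<in> topspace X"
  with assms(2) obtain U c where U: "openin X U" "x \<in> U" "\<And>y. y \<in> U \<Longrightarrow> f y = c"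
    by (rule locally_constantE) blast
  moreover have "g y = c" if "y \<in> U" for y
    using that U assms(1)[of y] openin_subset[OF U(1)] by auto
  ultimately show "\<exists>U c. openin X U \<and> x \<in> U \<and> (\<forall>y\<in>U. g y = c)" by blast
qed

lemma openin_Collect_Bex:
  assumes "\<And>a. a \<in> A \<Longrightarrow> openin X {x \<in> topspace X. P x a}"
  shows "openin X {x \<in> topspace X. \<exists>a\<in>A. P x a}"
proof -
  have "{x \<in> topspace X. \<exists>a\<in>A. P x a} = (\<Union>a\<in>A. {x \<in> topspace X. P x a})" by auto
  then show ?thesis using assms by auto
qed

lemma gdelta_in_Collect_Ball:
  assumes "countable A" "\<And>a. a \<in> A \<Longrightarrow> openin X {x \<in> topspace X. P x a}"
  shows "gdelta_in X {x \<in> topspace X. \<forall>a\<in>A. P x a}"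
proof (cases "A = {}")
  case False
  then have "{x \<in> topspace X. \<forall>a\<in>A. P x a} = \<Inter> ((\<lambda>a. {x \<in> topspace X. P x a}) ` A)"
    by auto
  moreover have "gdelta_in X (\<Inter> ((\<lambda>a. {x \<in> topspace X. P x a}) ` A))"
    using assms False by (intro gdelta_in_Inter) (auto intro: open_imp_gdelta_in)
  ultimately show ?thesis by simp
qed simp

section \<open>The space of enumerated groups\<close>

lemma completely_metrizable_structure_space: "completely_metrizable_space structure_space"
  unfolding structure_space_def
  by (simp add: completely_metrizable_space_prod_topology completely_metrizable_space_product_topology
      completely_metrizable_space_discrete_topology)

lemma second_countable_structure_space: "second_countable structure_space"
  unfolding structure_space_def
  by (intro second_countable_prod_topology second_countable_product_topology)
     (auto simp: second_countable_discrete_topology)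

lemma structure_projections:
  "continuous_map structure_space (product_topology (\<lambda>_. discrete_topology Npos) (Npos \<times> Npos)) fst"
  "continuous_map structure_space (product_topology (\<lambda>_. discrete_topology Npos) Npos) (fst \<circ> snd)"
  "continuous_map structure_space (discrete_topology Npos) (snd \<circ> snd)"
  unfolding structure_space_def
  by (auto intro: continuous_map_fst continuous_map_compose[OF continuous_map_snd] continuous_map_snd)

lemma locally_constant_structure_mult:
  assumes "x \<in> Npos" "y \<in> Npos"
  shows "locally_constant structure_space (\<lambda>p. fst p (x, y))"
proof (rule locally_constant_continuous)
  show "continuous_map structure_space (discrete_topology Npos) (\<lambda>p. fst p (x, y))"
    using continuous_map_compose[OF structure_projections(1)
        continuous_map_product_projection[of "(x, y)" "Npos \<times> Npos"]] assms
    by (simp add: comp_def)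
qed

lemma locally_constant_structure_inv:
  assumes "x \<in> Npos"
  shows "locally_constant structure_space (\<lambda>p. fst (snd p) x)"
proof (rule locally_constant_continuous)
  show "continuous_map structure_space (discrete_topology Npos) (\<lambda>p. fst (snd p) x)"
    using continuous_map_compose[OF structure_projections(2)
        continuous_map_product_projection[of x Npos]] assms
    by (simp add: comp_def)
qed

lemma locally_constant_structure_one: "locally_constant structure_space (\<lambda>p. snd (snd p))"
  using locally_constant_continuous[OF structure_projections(3)] by (simp add: comp_def)

lemma structure_space_closed:
  assumes "p \<in> topspace structure_space"
  shows "x \<in> Npos \<Longrightarrow> y \<in> Npos \<Longrightarrow> fst p (x, y) \<in> Npos"
    and "x \<in> Npos \<Longrightarrow> fst (snd p) x \<in> Npos"
    and "snd (snd p) \<in> Npos"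
proof -
  obtain m i e where "p = (m, i, e)" by (metis surj_pair)
  then have p: "p = (m, i, e)" "m \<in> (Npos \<times> Npos) \<rightarrow>\<^sub>E Npos" "i \<in> Npos \<rightarrow>\<^sub>E Npos" "e \<in> Npos"
    using assms by (simp_all add: structure_space_def)
  show "x \<in> Npos \<Longrightarrow> y \<in> Npos \<Longrightarrow> fst p (x, y) \<in> Npos"
    using PiE_mem[OF p(2), of "(x, y)"] p(1) by simp
  show "x \<in> Npos \<Longrightarrow> fst (snd p) x \<in> Npos"
    using PiE_mem[OF p(3), of x] p(1) by simp
  show "snd (snd p) \<in> Npos" using p by simp
qed

text \<open>The inversion table being part of the structure, the group axioms become identities without
  existential quantifiers.  This makes the enumerated groups a closed set.\<close>

lemma enumerated_groups_iff:
  "p \<in> enumerated_groups \<longleftrightarrow> p \<in> topspace structure_space \<and>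
     (\<forall>x\<in>Npos. \<forall>y\<in>Npos. \<forall>z\<in>Npos. fst p (fst p (x, y), z) = fst p (x, fst p (y, z))) \<and>
     (\<forall>x\<in>Npos. fst p (snd (snd p), x) = x) \<and>
     (\<forall>x\<in>Npos. fst p (fst (snd p) x, x) = snd (snd p))"
    (is "_ \<longleftrightarrow> ?T \<and> ?A \<and> ?B \<and> ?C")
proof -
  obtain m i e where p: "p = (m, i, e)" by (metis surj_pair)
  let ?G = "group_of (m, i, e)"
  show ?thesis
  proof
    assume "p \<in> enumerated_groups"
    then have T: ?T and G: "group ?G" and i: "\<And>x. x \<in> Npos \<Longrightarrow> i x = inv\<^bsub>?G\<^esub> x"
      by (auto simp: enumerated_groups_def p)
    interpret group ?G by (rule G)
    have ?A using m_assoc by (auto simp: p)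
    moreover have ?B using l_one by (auto simp: p)
    moreover have ?C using l_inv i by (auto simp: p)
    ultimately show "?T \<and> ?A \<and> ?B \<and> ?C" using T by blast
  next
    assume h: "?T \<and> ?A \<and> ?B \<and> ?C"
    note cl = structure_space_closed[OF conjunct1[OF h]]
    have G: "group ?G"
      using h cl by (intro groupI) (auto simp: p)
    interpret group ?G by (rule G)
    have "i x = inv\<^bsub>?G\<^esub> x" if "x \<in> Npos" for x
      using that h cl(2)[of x] by (intro inv_equality[symmetric]) (auto simp: p)
    then show "p \<in> enumerated_groups"
      using h G by (auto simp: enumerated_groups_def p)
  qed
qed

lemma locally_constant_mult:
  assumes "\<And>x y. x \<in> Npos \<Longrightarrow> y \<in> Npos \<Longrightarrow> locally_constant X (\<lambda>p. fst p (x, y))"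
    and "locally_constant X f" "locally_constant X g"
    and "\<And>p. p \<in> topspace X \<Longrightarrow> f p \<in> Npos" "\<And>p. p \<in> topspace X \<Longrightarrow> g p \<in> Npos"
  shows "locally_constant X (\<lambda>p. fst p (f p, g p))"
proof (rule locally_constant_diagonal[of X "\<lambda>p. (f p, g p)" "\<lambda>p c. fst p c"])
  show "locally_constant X (\<lambda>p. (f p, g p))"
    by (rule locally_constant_compose2[OF assms(2,3)])
  show "locally_constant X (\<lambda>p. fst p c)" if "c \<in> (\<lambda>p. (f p, g p)) ` topspace X" for c
    using that assms(1,4,5) by auto
qed

lemma closedin_enumerated_groups: "closedin structure_space enumerated_groups"
proof -
  note lc = locally_constant_mult[OF locally_constant_structure_mult] locally_constant_structure_mult
    locally_constant_structure_inv locally_constant_structure_one locally_constant_const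
    structure_space_closed
  have eq: "enumerated_groups = {p \<in> topspace structure_space.
     (\<forall>x\<in>Npos. \<forall>y\<in>Npos. \<forall>z\<in>Npos. fst p (fst p (x, y), z) = fst p (x, fst p (y, z))) \<and>
     (\<forall>x\<in>Npos. fst p (snd (snd p), x) = x) \<and>
     (\<forall>x\<in>Npos. fst p (fst (snd p) x, x) = snd (snd p))}"
    using enumerated_groups_iff by blast
  show ?thesis
    unfolding eq
    by (intro closedin_Collect_conj closedin_Collect_Ball closedin_Collect_eq_locally_constant lc)
qed

lemma topspace_enum_group_space: "topspace enum_group_space = enumerated_groups"
  using closedin_subset[OF closedin_enumerated_groups] by (auto simp: enum_group_space_def)

lemma completely_metrizable_enum_group_space: "completely_metrizable_space enum_group_space"
  unfolding enum_group_space_def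
  using completely_metrizable_space_closedin completely_metrizable_structure_space
    closedin_enumerated_groups by blast

lemma second_countable_enum_group_space: "second_countable enum_group_space"
  unfolding enum_group_space_def
  by (rule second_countable_subtopology[OF second_countable_structure_space])

lemma group_group_of: "p \<in> enumerated_groups \<Longrightarrow> group (group_of p)"
  by (auto simp: enumerated_groups_def)

lemma group_of_simps:
  "carrier (group_of p) = Npos" "x \<otimes>\<^bsub>group_of p\<^esub> y = fst p (x, y)" "\<one>\<^bsub>group_of p\<^esub> = snd (snd p)"
  by (cases p; simp)+

lemma inv_group_of:
  "p \<in> enumerated_groups \<Longrightarrow> x \<in> Npos \<Longrightarrow> inv\<^bsub>group_of p\<^esub> x = fst (snd p) x"
  by (auto simp: enumerated_groups_def)

section \<open>Reduced words and free subgroups\<close>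

lemma freely_reduced_Nil [simp]: "freely_reduced []"
  by (simp add: freely_reduced_def)

lemma freely_reduced_Cons:
  "freely_reduced (l # w) \<longleftrightarrow> w = [] \<or> \<not> inverse_letters l (hd w) \<and> freely_reduced w"
  by (auto simp: freely_reduced_def successively_Cons)

lemma freely_reduced_append:
  "freely_reduced (u @ v) \<longleftrightarrow> freely_reduced u \<and> freely_reduced v \<and>
     (u = [] \<or> v = [] \<or> \<not> inverse_letters (last u) (hd v))"
  by (simp add: freely_reduced_def successively_append_iff)

lemma freely_reduced_cons_reduce: "freely_reduced w \<Longrightarrow> freely_reduced (cons_reduce l w)"
  by (cases w) (auto simp: freely_reduced_Cons)

lemma freely_reduced_reduce_word: "freely_reduced (reduce_word w)"
  by (induction w) (simp_all add: reduce_word_def freely_reduced_cons_reduce)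

lemma reduce_word_freely_reduced: "freely_reduced w \<Longrightarrow> reduce_word w = w"
proof (induction w)
  case (Cons l w)
  then show ?case by (cases w) (auto simp: reduce_word_def freely_reduced_Cons)
qed (simp add: reduce_word_def)

lemma set_cons_reduce: "set (cons_reduce l w) \<subseteq> insert l (set w)"
  by (cases w) auto

lemma set_reduce_word: "set (reduce_word w) \<subseteq> set w"
proof (induction w)
  case (Cons l w)
  then show ?case using set_cons_reduce[of l "reduce_word w"] by (auto simp: reduce_word_def)
qed (simp add: reduce_word_def)

lemma carrier_free_group: "w \<in> carrier (free_group X) \<longleftrightarrow> freely_reduced w \<and> fst ` set w \<subseteq> X"
  by (simp add: free_group_def)

lemma mult_free_group: "u \<otimes>\<^bsub>free_group X\<^esub> v = reduce_word (u @ v)"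
  by (simp add: free_group_def)

lemma free_group_mult_closed:
  "u \<in> carrier (free_group X) \<Longrightarrow> v \<in> carrier (free_group X) \<Longrightarrow>
    u \<otimes>\<^bsub>free_group X\<^esub> v \<in> carrier (free_group X)"
  using set_reduce_word[of "u @ v"]
  by (fastforce simp: carrier_free_group mult_free_group freely_reduced_reduce_word)

definition inverse_word :: "'x group_word \<Rightarrow> 'x group_word" where
  "inverse_word w = rev (map (\<lambda>(x, b). (x, \<not> b)) w)"

lemma freely_reduced_inverse_word:
  "freely_reduced w \<Longrightarrow> freely_reduced (inverse_word w)"
  unfolding freely_reduced_def inverse_word_def successively_rev successively_map
  by (erule successively_mono) (auto simp: inverse_letters_def)

lemma letters_inverse_word: "fst ` set (inverse_word w) = fst ` set w"
  by (force simp: inverse_word_def image_iff)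

context group
begin

lemma word_value_Nil [simp]: "word_value G a [] = \<one>"
  by (simp add: word_value_def)

lemma word_value_Cons: "word_value G a (l # w) = letter_value G a l \<otimes> word_value G a w"
  by (simp add: word_value_def)

context
  fixes a :: "'x \<Rightarrow> 'a"
  assumes a: "\<And>x. a x \<in> carrier G"
begin

lemma letter_value_closed: "letter_value G a l \<in> carrier G"
  using a by (cases l) auto

lemma word_value_closed: "word_value G a w \<in> carrier G"
  by (induction w) (simp_all add: word_value_Cons letter_value_closed)

lemma word_value_append: "word_value G a (u @ v) = word_value G a u \<otimes> word_value G a v"
  by (induction u) (simp_all add: word_value_Cons letter_value_closed word_value_closed m_assoc)

lemma letter_value_inverse_letters:
  "inverse_letters l k \<Longrightarrow> letter_value G a l = inv (letter_value G a k)"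
  using a by (cases l; cases k) (auto simp: inverse_letters_def)

lemma word_value_cons_reduce:
  "word_value G a (cons_reduce l w) = letter_value G a l \<otimes> word_value G a w"
proof (cases w)
  case (Cons k v)
  then show ?thesis
    using letter_value_closed word_value_closed
    by (auto simp: word_value_Cons letter_value_inverse_letters simp flip: m_assoc)
qed (simp add: word_value_Cons)

lemma word_value_reduce_word: "word_value G a (reduce_word w) = word_value G a w"
  by (induction w) (simp_all add: reduce_word_def word_value_cons_reduce word_value_Cons)

lemma word_value_inverse_word: "word_value G a (inverse_word w) = inv (word_value G a w)"
proof (induction w)
  case (Cons l w)
  have "letter_value G a (fst l, \<not> snd l) = inv (letter_value G a l)"
    using a by (cases l) auto
  moreover have "inverse_word (l # w) = inverse_word w @ [(fst l, \<not> snd l)]"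
    by (cases l) (simp add: inverse_word_def)
  ultimately show ?case
    using Cons letter_value_closed word_value_closed
    by (simp add: word_value_append word_value_Cons inv_mult_group)
qed (simp add: inverse_word_def)

text \<open>If \<open>u\<close> and \<open>v\<close> are different reduced words, then after cancelling their common prefix the word
  \<open>u\<inverse> v\<close> is reduced and nonempty.  So a tuple that satisfies no nontrivial relation takes
  different values at different reduced words.\<close>

lemma word_value_inj:
  assumes nontriv: "\<And>w. w \<in> carrier (free_group X) \<Longrightarrow> w \<noteq> [] \<Longrightarrow> word_value G a w \<noteq> \<one>"
  assumes "u \<in> carrier (free_group X)" "v \<in> carrier (free_group X)"
    and "word_value G a u = word_value G a v"
  shows "u = v"
  using assms(2-)
proof (induction u arbitrary: v)
  case Nil
  then show ?case using nontriv[of v] by auto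
next
  case (Cons l u)
  have "v \<noteq> []" using Cons.prems nontriv[of "l # u"] by auto
  then obtain k v' where v: "v = k # v'" by (cases v) auto
  show ?case
  proof (cases "l = k")
    case True
    then have "word_value G a u = word_value G a v'"
      using Cons.prems(3) letter_value_closed word_value_closed
      by (simp add: v word_value_Cons)
    then show ?thesis
      using Cons.IH[of v'] Cons.prems(1,2) True
      by (auto simp: v carrier_free_group freely_reduced_Cons)
  next
    case False
    let ?w = "inverse_word (l # u) @ v"
    have "last (inverse_word (l # u)) = (fst l, \<not> snd l)"
      by (cases l) (simp add: inverse_word_def)
    then have "\<not> inverse_letters (last (inverse_word (l # u))) (hd v)"
      using False by (cases l; cases k) (auto simp: v inverse_letters_def)
    moreover have "freely_reduced (inverse_word (l # u))"
      using Cons.prems by (intro freely_reduced_inverse_word) (simp add: carrier_free_group)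
    ultimately have "?w \<in> carrier (free_group X)"
      using Cons.prems letters_inverse_word[of "l # u"]
      by (simp add: carrier_free_group freely_reduced_append image_Un)
    moreover have "word_value G a ?w = \<one>"
      using Cons.prems word_value_closed by (simp add: word_value_append word_value_inverse_word)
    ultimately show ?thesis using nontriv[of ?w] v by simp
  qed
qed

lemma subgroup_word_values: "subgroup (word_value G a ` carrier (free_group X)) G"
proof
  let ?H = "word_value G a ` carrier (free_group X)"
  show "?H \<subseteq> carrier G" using word_value_closed by blast
  show "\<one> \<in> ?H"
    by (rule image_eqI[of _ _ "[]"]) (simp_all add: carrier_free_group)
  show "g \<otimes> h \<in> ?H" if gh: "g \<in> ?H" "h \<in> ?H" for g h
  proof -
    obtain u v where "u \<in> carrier (free_group X)" "v \<in> carrier (free_group X)"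
      "g = word_value G a u" "h = word_value G a v" using gh by blast
    then show ?thesis
      by (intro image_eqI[of _ _ "u \<otimes>\<^bsub>free_group X\<^esub> v"])
         (simp_all only: free_group_mult_closed, simp add: mult_free_group word_value_reduce_word word_value_append)
  qed
  show "inv g \<in> ?H" if g: "g \<in> ?H" for g
  proof -
    obtain u where "u \<in> carrier (free_group X)" "g = word_value G a u" using g by blast
    then show ?thesis
      by (intro image_eqI[of _ _ "inverse_word u"])
         (simp_all add: word_value_inverse_word carrier_free_group freely_reduced_inverse_word letters_inverse_word)
  qed
qed

lemma free_group_iso_word_values:
  assumes nontriv: "\<And>w. w \<in> carrier (free_group X) \<Longrightarrow> w \<noteq> [] \<Longrightarrow> word_value G a w \<noteq> \<one>"
  shows "G\<lparr>carrier := word_value G a ` carrier (free_group X)\<rparr> \<cong> free_group X"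
proof -
  let ?F = "carrier (free_group X)"
  let ?f = "word_value G a"
  define h where "h = inv_into ?F ?f"
  have inj: "inj_on ?f ?F"
    using word_value_inj[OF nontriv] by (intro inj_onI)
  have hf: "h (?f u) = u" if "u \<in> ?F" for u
    using inj that by (simp add: h_def)
  have "bij_betw h (?f ` ?F) ?F"
    unfolding h_def by (intro bij_betw_inv_into inj_on_imp_bij_betw inj)
  moreover have "h (?f u \<otimes> ?f v) = h (?f u) \<otimes>\<^bsub>free_group X\<^esub> h (?f v)" if "u \<in> ?F" "v \<in> ?F" for u v
  proof -
    have "?f u \<otimes> ?f v = ?f (u \<otimes>\<^bsub>free_group X\<^esub> v)"
      by (simp add: mult_free_group word_value_reduce_word word_value_append)
    then show ?thesis using that by (simp add: hf free_group_mult_closed)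
  qed
  ultimately have "h \<in> iso (G\<lparr>carrier := ?f ` ?F\<rparr>) (free_group X)"
    by (auto simp: iso_def hom_def hf)
  then show ?thesis by (auto simp: is_iso_def)
qed

end

text \<open>A reduced word is the product of its letters in the free group, so a homomorphism is determined
  by the images of the generators: it is evaluation at those images.\<close>

lemma iso_free_group_word_value:
  assumes H: "subgroup H G" and k: "k \<in> iso (free_group X) (G\<lparr>carrier := H\<rparr>)"
    and a: "\<And>x. a x \<in> carrier G" "\<And>x. x \<in> X \<Longrightarrow> a x = k [(x, True)]"
    and w: "w \<in> carrier (free_group X)"
  shows "k w = word_value G a w"
proof -
  let ?F = "carrier (free_group X)"
  have kH: "k u \<in> H" if "u \<in> ?F" for u
    using k that by (auto simp: iso_def hom_def)
  then have kG: "k u \<in> carrier G" if "u \<in> ?F" for u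
    using that subgroup.subset[OF H] by auto
  have km: "k (reduce_word (u @ v)) = k u \<otimes> k v" if "u \<in> ?F" "v \<in> ?F" for u v
    using k that by (auto simp: iso_def hom_def mult_free_group)
  have nil: "[] \<in> ?F" by (simp add: carrier_free_group)
  then have "k [] = k [] \<otimes> k []" using km[of "[]" "[]"] by (simp add: reduce_word_def)
  then have k1: "k [] = \<one>" using kG[OF nil] by (simp add: r_cancel_one')
  have letter: "k [l] = letter_value G a l" if "fst l \<in> X" for l
  proof (cases l)
    case (Pair x b)
    have F: "[(x, True)] \<in> ?F" "[(x, False)] \<in> ?F"
      using that by (auto simp: Pair carrier_free_group freely_reduced_Cons)
    have "k [(x, False)] \<otimes> k [(x, True)] = k (reduce_word ([(x, False)] @ [(x, True)]))"
      using km F by metis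
    also have "\<dots> = \<one>" using k1 by (simp add: reduce_word_def inverse_letters_def)
    finally have "k [(x, False)] = inv (k [(x, True)])"
      using kG F by (metis inv_equality)
    then show ?thesis using a(2)[of x] that by (cases b) (simp_all add: Pair)
  qed
  show ?thesis
    using w
  proof (induction w)
    case Nil then show ?case using k1 by simp
  next
    case (Cons l w)
    then have F: "[l] \<in> ?F" "w \<in> ?F"
      by (auto simp: carrier_free_group freely_reduced_Cons)
    have "k (l # w) = k (reduce_word ([l] @ w))"
      using Cons.prems reduce_word_freely_reduced[of "l # w"] by (simp add: carrier_free_group)
    also have "\<dots> = k [l] \<otimes> k w" using km F by blast
    also have "\<dots> = word_value G a (l # w)"
      using letter[of l] Cons F by (simp add: word_value_Cons carrier_free_group)
    finally show ?case .
  qed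
qed

text \<open>Containing a free subgroup of rank 2 means that some pair of elements satisfies no nontrivial
  relation.  The subgroup is replaced by a pair because a pair involves only two natural numbers,
  and a single relation only finitely many table entries.\<close>

lemma contains_F2_iff:
  "contains_F2 G \<longleftrightarrow> (\<exists>x\<in>carrier G. \<exists>y\<in>carrier G.
     \<forall>w\<in>carrier (free_group {0, 1 :: nat}). w \<noteq> [] \<longrightarrow> word_value G (\<lambda>n. if n = 0 then x else y) w \<noteq> \<one>)"
proof
  assume "contains_F2 G"
  then obtain H h where H: "subgroup H G" and h: "h \<in> iso (G\<lparr>carrier := H\<rparr>) (free_group {0, 1 :: nat})"
    by (auto simp: contains_F2_def is_iso_def)
  let ?F = "free_group {0, 1 :: nat}"
  interpret GH: group "G\<lparr>carrier := H\<rparr>"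
    using H subgroup.subgroup_is_group by (simp add: subgroup_imp_group)
  define k where "k = inv_into (carrier (G\<lparr>carrier := H\<rparr>)) h"
  have k: "k \<in> iso ?F (G\<lparr>carrier := H\<rparr>)"
    unfolding k_def by (rule GH.iso_set_sym[OF h])
  then have kb: "bij_betw k (carrier ?F) H" by (simp add: iso_def)
  define x where "x = k [(0, True)]"
  define y where "y = k [(1, True)]"
  have F: "[(0, True)] \<in> carrier ?F" "[(1, True)] \<in> carrier ?F" "[] \<in> carrier ?F"
    by (auto simp: carrier_free_group freely_reduced_Cons)
  have xy: "x \<in> carrier G" "y \<in> carrier G"
    using F bij_betw_apply[OF kb] subgroup.subset[OF H] by (auto simp: x_def y_def)
  let ?a = "\<lambda>n. if n = 0 then x else y"
  have val: "k w = word_value G ?a w" if "w \<in> carrier ?F" for w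
    using that xy by (intro iso_free_group_word_value[OF H k]) (auto simp: x_def y_def)
  have "word_value G ?a w \<noteq> \<one>" if "w \<in> carrier ?F" "w \<noteq> []" for w
    using inj_onD[OF bij_betw_imp_inj_on[OF kb], of w "[]"] that F(3)
    by (auto simp: val)
  then show "\<exists>x\<in>carrier G. \<exists>y\<in>carrier G. \<forall>w\<in>carrier ?F. w \<noteq> [] \<longrightarrow>
      word_value G (\<lambda>n. if n = 0 then x else y) w \<noteq> \<one>"
    using xy by blast
next
  assume "\<exists>x\<in>carrier G. \<exists>y\<in>carrier G. \<forall>w\<in>carrier (free_group {0, 1 :: nat}). w \<noteq> [] \<longrightarrow>
      word_value G (\<lambda>n. if n = 0 then x else y) w \<noteq> \<one>"
  then obtain x y where xy: "x \<in> carrier G" "y \<in> carrier G"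
    and nt: "\<And>w. w \<in> carrier (free_group {0, 1 :: nat}) \<Longrightarrow> w \<noteq> [] \<Longrightarrow>
      word_value G (\<lambda>n. if n = 0 then x else y) w \<noteq> \<one>"
    by blast
  let ?a = "\<lambda>n :: nat. if n = 0 then x else y"
  have a: "?a n \<in> carrier G" for n using xy by simp
  have "subgroup (word_value G ?a ` carrier (free_group {0, 1 :: nat})) G"
    by (rule subgroup_word_values[OF a])
  moreover have "G\<lparr>carrier := word_value G ?a ` carrier (free_group {0, 1 :: nat})\<rparr> \<cong> free_group {0, 1 :: nat}"
    by (rule free_group_iso_word_values[OF a nt])
  ultimately show "contains_F2 G" unfolding contains_F2_def by (intro exI conjI)
qed

end

section \<open>The marriage theorem for infinite families\<close>

text \<open>Hall's marriage theorem for an arbitrary family of finite sets, following Rado.  A pair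
  \<open>(i, x)\<close> may be deleted from the relation \<open>x \<in> A i\<close> as long as Hall's condition
  survives; a maximal set \<open>M\<close> of deletions exists by Zorn's lemma, because the condition for a
  fixed finite \<open>J\<close> concerns only finitely many pairs.  If two candidates \<open>x\<close> and \<open>y\<close> remained
  for the same \<open>i\<close>, then deleting either one would violate the condition, say at \<open>J\<close> and at \<open>K\<close>;
  counting the union and the intersection of the two sets of candidates contradicts the condition
  at \<open>J \<union> K\<close> and \<open>J \<inter> K - {i}\<close>.  So exactly one candidate is left for each
  index, and candidates of different indices differ by the condition at two-element sets.\<close>

theorem infinite_marriage:
  fixes A :: "'i \<Rightarrow> 'a set"
  assumes fin: "\<And>i. i \<in> I \<Longrightarrow> finite (A i)"
    and hall: "\<And>J. finite J \<Longrightarrow> J \<subseteq> I \<Longrightarrow> card J \<le> card (\<Union> (A ` J))"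
  obtains f where "inj_on f I" "\<And>i. i \<in> I \<Longrightarrow> f i \<in> A i"
proof -
  define R where "R = Sigma I A"
  have finR: "finite ((R - D) `` J)" if "finite J" "J \<subseteq> I" for D J
  proof -
    have "(R - D) `` J \<subseteq> \<Union> (A ` J)" by (auto simp: R_def)
    moreover have "finite (\<Union> (A ` J))" using that fin by blast
    ultimately show ?thesis by (rule finite_subset)
  qed
  define \<D> where "\<D> = {D. D \<subseteq> R \<and> (\<forall>J. finite J \<and> J \<subseteq> I \<longrightarrow> card J \<le> card ((R - D) `` J))}"
  have "\<exists>M\<in>\<D>. \<forall>X\<in>\<D>. M \<subseteq> X \<longrightarrow> X = M"
  proof (rule subset_Zorn_nonempty)
    have "R `` J = \<Union> (A ` J)" if "J \<subseteq> I" for J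
      using that by (auto simp: R_def)
    then have "{} \<in> \<D>" using hall by (simp add: \<D>_def)
    then show "\<D> \<noteq> {}" by blast
    fix \<C> assume "\<C> \<noteq> {}" and ch: "subset.chain \<D> \<C>"
    have sub: "\<C> \<subseteq> \<D>" using ch by (simp add: subset_chain_def)
    have "card J \<le> card ((R - \<Union>\<C>) `` J)" if J: "finite J" "J \<subseteq> I" for J
    proof -
      let ?T = "\<Union>\<C> \<inter> Sigma J A"
      have "finite (Sigma J A)" using J fin by auto
      then have "finite ?T" by blast
      then obtain D where D: "D \<in> \<C>" "?T \<subseteq> D"
        using finite_subset_Union_chain[of ?T \<C> \<D>] \<open>\<C> \<noteq> {}\<close> ch by blast
      have "(R - D) `` J = (R - \<Union>\<C>) `` J"
        using D J by (auto simp: R_def)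
      moreover have "card J \<le> card ((R - D) `` J)"
        using D(1) sub J unfolding \<D>_def by blast
      ultimately show ?thesis by simp
    qed
    moreover have "\<Union>\<C> \<subseteq> R" using sub by (auto simp: \<D>_def)
    ultimately show "\<Union>\<C> \<in> \<D>" by (simp add: \<D>_def)
  qed
  (* B J is the set of candidates of the indices in J that survive the deletions in M. *)
  then obtain M where M: "M \<in> \<D>" and max: "\<And>D. D \<in> \<D> \<Longrightarrow> M \<subseteq> D \<Longrightarrow> D = M" by blast
  define B where "B J = (R - M) `` J" for J
  have B_hall: "card J \<le> card (B J)" if "finite J" "J \<subseteq> I" for J
    using M that by (simp add: \<D>_def B_def)
  have violated: "\<exists>J. finite J \<and> J \<subseteq> I \<and> i \<in> J \<and> card ((R - insert (i, x) M) `` J) < card J"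
    if i: "i \<in> I" and x: "x \<in> B {i}" for i x
  proof -
    have "(i, x) \<in> R - M" using x by (simp add: B_def)
    then have "insert (i, x) M \<notin> \<D>" using max[of "insert (i, x) M"] by blast
    moreover have "insert (i, x) M \<subseteq> R" using \<open>(i, x) \<in> R - M\<close> M by (auto simp: \<D>_def)
    ultimately obtain J where J: "finite J" "J \<subseteq> I" "card ((R - insert (i, x) M) `` J) < card J"
      unfolding \<D>_def by (auto simp: not_le)
    have "i \<in> J"
    proof (rule ccontr)
      assume "i \<notin> J"
      then have "(R - insert (i, x) M) `` J = B J" by (auto simp: B_def)
      then show False using J B_hall[of J] by simp
    qed
    then show ?thesis using J by blast
  qed
  have unique: "x = y" if i: "i \<in> I" and x: "x \<in> B {i}" and y: "y \<in> B {i}" for i x y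
  proof (rule ccontr)
    assume "x \<noteq> y"
    obtain J where J: "finite J" "J \<subseteq> I" "i \<in> J" "card ((R - insert (i, x) M) `` J) < card J"
      using violated[OF i x] by blast
    obtain K where K: "finite K" "K \<subseteq> I" "i \<in> K" "card ((R - insert (i, y) M) `` K) < card K"
      using violated[OF i y] by blast
    define P where "P = (R - insert (i, x) M) `` J"
    define Q where "Q = (R - insert (i, y) M) `` K"
    have finPQ: "finite P" "finite Q" using finR J K by (auto simp: P_def Q_def)
    have "B (J \<union> K) \<subseteq> P \<union> Q"
      using \<open>x \<noteq> y\<close> J(3) K(3) by (auto simp: B_def P_def Q_def)
    then have "card (J \<union> K) \<le> card (P \<union> Q)"
      using B_hall[of "J \<union> K"] J K finPQ by (meson card_mono finite_UnI le_trans Un_least)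
    moreover have "B (J \<inter> K - {i}) \<subseteq> P \<inter> Q"
      by (auto simp: B_def P_def Q_def)
    then have "card (J \<inter> K - {i}) \<le> card (P \<inter> Q)"
      using B_hall[of "J \<inter> K - {i}"] J K finPQ
      by (meson Diff_subset card_mono finite_Diff finite_Int inf.coboundedI1 le_trans order_trans)
    moreover have "card (J \<inter> K) = Suc (card (J \<inter> K - {i}))"
      using J K by (intro card.remove) auto
    moreover have "card P + card Q = card (P \<union> Q) + card (P \<inter> Q)"
      using finPQ by (rule card_Un_Int)
    moreover have "card J + card K = card (J \<union> K) + card (J \<inter> K)"
      using J K by (intro card_Un_Int)
    ultimately show False using J(4) K(4) unfolding P_def[symmetric] Q_def[symmetric] by linarith
  qed
  have "\<exists>x. x \<in> B {i}" if "i \<in> I" for i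
    using B_hall[of "{i}"] that by (cases "B {i} = {}") auto
  then obtain f where f: "\<And>i. i \<in> I \<Longrightarrow> f i \<in> B {i}" by metis
  have "inj_on f I"
  proof (rule inj_onI, rule ccontr)
    fix i j assume ij: "i \<in> I" "j \<in> I" "f i = f j" "i \<noteq> j"
    have "B {i, j} \<subseteq> {f i}"
    proof
      fix x assume "x \<in> B {i, j}"
      then have "x \<in> B {i} \<or> x \<in> B {j}" by (auto simp: B_def)
      then show "x \<in> {f i}" using unique f ij by (metis singletonI)
    qed
    then have "card (B {i, j}) \<le> 1" using card_mono[of "{f i}"] by fastforce
    then show False using B_hall[of "{i, j}"] ij by simp
  qed
  moreover have "f i \<in> A i" if "i \<in> I" for i
    using f[OF that] by (simp add: B_def R_def)
  ultimately show thesis by (rule that)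
qed

section \<open>Amenability and small doubling\<close>

lemma finitely_additive_UN:
  fixes \<mu> :: "'a set \<Rightarrow> real"
  assumes add: "\<And>A B. A \<subseteq> \<Omega> \<Longrightarrow> B \<subseteq> \<Omega> \<Longrightarrow> A \<inter> B = {} \<Longrightarrow> \<mu> (A \<union> B) = \<mu> A + \<mu> B"
    and "finite I" "\<And>i. i \<in> I \<Longrightarrow> E i \<subseteq> \<Omega>" "disjoint_family_on E I"
  shows "\<mu> (\<Union> (E ` I)) = (\<Sum>i\<in>I. \<mu> (E i))"
  using assms(2-)
proof (induction I rule: finite_induct)
  case empty
  then show ?case using add[of "{}" "{}"] by simp
next
  case (insert i I)
  have "E i \<inter> \<Union> (E ` I) = {}"
    using insert.prems(2) insert.hyps(2) by (auto simp: disjoint_family_on_def)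
  then have "\<mu> (E i \<union> \<Union> (E ` I)) = \<mu> (E i) + \<mu> (\<Union> (E ` I))"
    using insert.prems by (intro add) auto
  then show ?case using insert by (simp add: disjoint_family_on_insert)
qed

text \<open>If left multiplication by \<open>S\<close> at least doubled every finite set, the marriage theorem would give
  an injection \<open>\<psi>\<close> from two copies of the group into the group that moves each point by an
  element of \<open>S\<close>.  Cutting each copy into the pieces \<open>E s b\<close> on which the same \<open>s\<close> is used yields a
  paradoxical decomposition: the pieces have total measure 2, and their translates are disjoint.\<close>

lemma (in group) amenable_imp_small_doubling:
  assumes am: "amenable G" and S: "finite S" "S \<subseteq> carrier G"
  shows "\<exists>F. finite F \<and> F \<noteq> {} \<and> F \<subseteq> carrier G \<and> card (S <#> F) < 2 * card F"
proof (rule ccontr)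
  assume "\<not> ?thesis"
  then have dbl: "2 * card F \<le> card (S <#> F)" if "finite F" "F \<subseteq> carrier G" for F
    using that by (cases "F = {}") (auto simp: not_less)
  obtain \<mu> :: "'a set \<Rightarrow> real" where one: "\<mu> (carrier G) = 1"
    and \<mu>: "\<forall>A. A \<subseteq> carrier G \<longrightarrow> 0 \<le> \<mu> A"
      "\<forall>A B. A \<subseteq> carrier G \<longrightarrow> B \<subseteq> carrier G \<longrightarrow> A \<inter> B = {} \<longrightarrow> \<mu> (A \<union> B) = \<mu> A + \<mu> B"
      "\<forall>g A. g \<in> carrier G \<longrightarrow> A \<subseteq> carrier G \<longrightarrow> \<mu> (g <# A) = \<mu> A"
    using am unfolding amenable_def by (elim exE conjE) (rule that)
  note nonneg = \<mu>(1)[rule_format] and add = \<mu>(2)[rule_format] and inv = \<mu>(3)[rule_format]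
  (* The Boolean tags the two copies of the group that are injected into one. *)
  obtain \<psi> :: "'a \<times> bool \<Rightarrow> 'a" where inj: "inj_on \<psi> (carrier G \<times> UNIV)"
    and \<psi>: "\<And>z. z \<in> carrier G \<times> UNIV \<Longrightarrow> \<psi> z \<in> (\<lambda>s. s \<otimes> fst z) ` S"
  proof (rule infinite_marriage[of "carrier G \<times> (UNIV :: bool set)" "\<lambda>z. (\<lambda>s. s \<otimes> fst z) ` S"])
    fix J assume J: "finite J" "J \<subseteq> carrier G \<times> (UNIV :: bool set)"
    have "J \<subseteq> fst ` J \<times> UNIV" by force
    then have "card J \<le> card (fst ` J \<times> (UNIV :: bool set))"
      using J by (intro card_mono) auto
    also have "\<dots> = 2 * card (fst ` J)" by (simp add: card_cartesian_product)
    also have "\<dots> \<le> card (S <#> fst ` J)" using J by (intro dbl) auto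
    also have "S <#> fst ` J = (\<Union>z\<in>J. (\<lambda>s. s \<otimes> fst z) ` S)" by (auto simp: set_mult_def)
    finally show "card J \<le> card (\<Union>z\<in>J. (\<lambda>s. s \<otimes> fst z) ` S)" .
  qed (use S in auto)
  define E where "E s b = {g \<in> carrier G. \<psi> (g, b) = s \<otimes> g}" for s b
  have total: "(\<Sum>s\<in>S. \<mu> (E s b)) = 1" for b
  proof -
    have "disjoint_family_on (\<lambda>s. E s b) S"
      using S(2) by (auto simp: disjoint_family_on_def E_def subset_iff)
    then have "\<mu> (\<Union>s\<in>S. E s b) = (\<Sum>s\<in>S. \<mu> (E s b))"
      by (intro finitely_additive_UN[where \<Omega> = "carrier G"] add S) (auto simp: E_def)
    moreover have "(\<Union>s\<in>S. E s b) = carrier G"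
      using \<psi> by (fastforce simp: E_def)
    ultimately show ?thesis using one by simp
  qed
  define T where "T = (\<lambda>(s, b). s <# E s b)"
  have T_eq: "T (s, b) = (\<lambda>g. \<psi> (g, b)) ` E s b" for s b
  proof -
    have "T (s, b) = (\<lambda>g. s \<otimes> g) ` E s b" by (auto simp: T_def l_coset_def)
    also have "\<dots> = (\<lambda>g. \<psi> (g, b)) ` E s b" by (intro image_cong) (simp_all add: E_def)
    finally show ?thesis .
  qed
  have "disjoint_family_on T (S \<times> UNIV)"
    unfolding disjoint_family_on_def
  proof (intro ballI impI, rule ccontr)
    fix z z' assume z: "z \<in> S \<times> (UNIV :: bool set)" "z' \<in> S \<times> (UNIV :: bool set)" "z \<noteq> z'"
      and "T z \<inter> T z' \<noteq> {}"
    obtain s b s' b' where zz: "z = (s, b)" "z' = (s', b')" by (metis surj_pair)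
    obtain g g' where g: "g \<in> E s b" "g' \<in> E s' b'" "\<psi> (g, b) = \<psi> (g', b')"
      using \<open>T z \<inter> T z' \<noteq> {}\<close> by (auto simp: zz T_eq)
    have "(g, b) = (g', b')"
      by (rule inj_onD[OF inj g(3)]) (use g(1,2) in \<open>auto simp: E_def\<close>)
    then have "g = g'" "b = b'" by simp_all
    then have "s \<otimes> g = s' \<otimes> g" using g by (simp add: E_def)
    then have "s = s'" using g z S by (auto simp: E_def zz subset_iff)
    then show False using z zz \<open>b = b'\<close> by simp
  qed
  moreover have Tsub: "T z \<subseteq> carrier G" if "z \<in> S \<times> UNIV" for z
    using that S(2) by (cases z) (auto simp: T_def l_coset_def E_def)
  ultimately have "\<mu> (\<Union> (T ` (S \<times> UNIV))) = (\<Sum>z\<in>S \<times> UNIV. \<mu> (T z))"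
    using S by (intro finitely_additive_UN[where \<Omega> = "carrier G"] add) auto
  also have "\<dots> = (\<Sum>z\<in>S \<times> UNIV. \<mu> (E (fst z) (snd z)))"
    using S(2) by (intro sum.cong refl) (auto simp: T_def E_def intro!: inv)
  also have "\<dots> = (\<Sum>s\<in>S. \<Sum>b\<in>UNIV. \<mu> (E s b))"
    by (simp add: sum.cartesian_product case_prod_beta)
  also have "\<dots> = 2" using total by (subst sum.swap) (simp add: UNIV_bool)
  finally have two: "\<mu> (\<Union> (T ` (S \<times> UNIV))) = 2" .
  let ?U = "\<Union> (T ` (S \<times> UNIV))"
  have U: "?U \<subseteq> carrier G" using Tsub by blast
  have "\<mu> (?U \<union> (carrier G - ?U)) = \<mu> ?U + \<mu> (carrier G - ?U)"
    using U by (intro add) auto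
  moreover have "?U \<union> (carrier G - ?U) = carrier G" using U by blast
  ultimately show False using two one nonneg[of "carrier G - ?U"] by simp
qed

text \<open>A single factor 2 already forces all the Folner ratios, by a power trick: if multiplication by
  \<open>S\<close> always enlarged by at least the factor \<open>1 + 1 / n\<close>, then multiplication by the \<open>n\<close>-fold
  product set of \<open>S\<close> would enlarge by \<open>(1 + 1 / n) ^ n \<ge> 2\<close>.\<close>

lemma (in group) small_doubling_imp_Folner:
  assumes small: "\<And>S. finite S \<Longrightarrow> S \<subseteq> carrier G \<Longrightarrow>
      \<exists>F. finite F \<and> F \<noteq> {} \<and> F \<subseteq> carrier G \<and> card (S <#> F) < 2 * card F"
    and S: "finite S" "S \<subseteq> carrier G" and n: "0 < n"
  shows "\<exists>F. finite F \<and> F \<noteq> {} \<and> F \<subseteq> carrier G \<and> n * card (S <#> F) < Suc n * card F"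
proof (rule ccontr)
  assume "\<not> ?thesis"
  then have grow: "Suc n * card F \<le> n * card (S <#> F)" if "finite F" "F \<subseteq> carrier G" for F
    using that by (cases "F = {}") (auto simp: not_less)
  have fin_mult: "finite (A <#> B)" if "finite A" "finite B" for A B
    using that by (simp add: set_mult_def)
  define T where "T k = ((\<lambda>A. S <#> A) ^^ k) {\<one>}" for k
  have T_simps: "T 0 = {\<one>}" "T (Suc k) = S <#> T k" for k by (simp_all add: T_def)
  have T: "finite (T k) \<and> T k \<subseteq> carrier G" for k
    by (induction k) (use S fin_mult set_mult_closed in \<open>simp_all add: T_simps\<close>)
  have pow: "Suc n ^ k * card F \<le> n ^ k * card (T k <#> F)" if F: "finite F" "F \<subseteq> carrier G" for k F
  proof (induction k)
    case 0
    have "{\<one>} <#> F = F" using F by (force simp: set_mult_def)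
    then show ?case by (simp add: T_simps)
  next
    case (Suc k)
    have "Suc n ^ Suc k * card F \<le> Suc n * (n ^ k * card (T k <#> F))"
      using Suc by (simp only: power_Suc mult.assoc mult_le_mono2)
    also have "\<dots> = n ^ k * (Suc n * card (T k <#> F))" by (simp only: mult.left_commute)
    also have "\<dots> \<le> n ^ k * (n * card (S <#> (T k <#> F)))"
      using T F by (intro mult_le_mono2 grow fin_mult set_mult_closed) auto
    also have "S <#> (T k <#> F) = T (Suc k) <#> F"
      using S T F by (simp add: T_simps set_mult_assoc)
    finally show ?case by (simp add: ac_simps)
  qed
  (* The exponent n suffices by the Bernoulli inequality. *)
  have "2 * real n ^ n \<le> (real n + 1) ^ n"
  proof -
    have "2 \<le> (1 + 1 / real n) ^ n"
      using Bernoulli_inequality[of "1 / real n" n] n by (simp add: field_simps)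
    then have "2 * real n ^ n \<le> (1 + 1 / real n) ^ n * real n ^ n"
      by (intro mult_right_mono) auto
    also have "\<dots> = (real n + 1) ^ n"
      using n by (simp add: field_simps flip: power_mult_distrib)
    finally show ?thesis .
  qed
  then have "real (2 * n ^ n) \<le> real (Suc n ^ n)" by (simp add: add.commute)
  then have bern: "2 * n ^ n \<le> Suc n ^ n" by (simp only: of_nat_le_iff)
  obtain F where F: "finite F" "F \<subseteq> carrier G" "card (T n <#> F) < 2 * card F"
    using small[of "T n"] T by blast
  have "n ^ n * (2 * card F) \<le> Suc n ^ n * card F"
    using bern by (metis mult.assoc mult.commute mult_le_mono1)
  also have "\<dots> \<le> n ^ n * card (T n <#> F)" using F pow by blast
  finally show False using F(3) n by simp
qed

text \<open>By Tychonoff, a sequence in a cube has a cluster point.  It is packaged as a proper filter below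
  the tail filter of the sequence, along which all coordinates converge simultaneously; this plays
  the role of an ultrafilter limit.\<close>

lemma bounded_functions_cluster_point:
  fixes m :: "nat \<Rightarrow> 'a \<Rightarrow> real"
  assumes bd: "\<And>n x. m n x \<in> {0..1}"
  obtains \<mu> H where "H \<noteq> bot" "H \<le> filtermap m sequentially" "\<And>x. \<mu> x \<in> {0..1}"
    "\<And>x. ((\<lambda>f. f x) \<longlongrightarrow> \<mu> x) H"
proof -
  let ?K = "PiE UNIV (\<lambda>_ :: 'a. {0..1 :: real})"
  have "compactin (product_topology (\<lambda>_ :: 'a. euclidean) UNIV) ?K"
    unfolding compactin_PiE by simp
  then have "compact ?K" by (simp add: euclidean_product_topology)
  moreover have "eventually (\<lambda>f. f \<in> ?K) (filtermap m sequentially)"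
    using bd by (simp add: eventually_filtermap PiE_UNIV_domain)
  moreover have "filtermap m sequentially \<noteq> bot" by (simp add: filtermap_bot_iff)
  ultimately obtain \<mu> where \<mu>: "\<mu> \<in> ?K" "inf (nhds \<mu>) (filtermap m sequentially) \<noteq> bot"
    unfolding compact_filter by blast
  show thesis
  proof (rule that[OF \<mu>(2)])
    show "\<mu> x \<in> {0..1}" for x using PiE_mem[OF \<mu>(1)] by simp
    have "((\<lambda>f :: 'a \<Rightarrow> real. f x) \<longlongrightarrow> \<mu> x) (at \<mu>)" for x
      using bspec[OF iffD1[OF continuous_on_def continuous_on_product_coordinates], of \<mu> x] by simp
    then have "((\<lambda>f. f x) \<longlongrightarrow> \<mu> x) (nhds \<mu>)" for x
      using tendsto_at_iff_tendsto_nhds[of "\<lambda>f. f x" \<mu>] by blast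
    then show "((\<lambda>f. f x) \<longlongrightarrow> \<mu> x) (inf (nhds \<mu>) (filtermap m sequentially))" for x
      by (rule tendsto_mono[rotated]) simp
  qed simp
qed

text \<open>Both \<open>F\<close> and \<open>g F\<close> lie in \<open>S F\<close> and have the same size, so trading one for the other changes
  any intersection count by at most \<open>|S F| - |F|\<close>.\<close>

lemma (in group) Folner_almost_invariant:
  assumes F: "finite F" "F \<subseteq> carrier G" and S: "finite S" "S \<subseteq> carrier G" "\<one> \<in> S" "g \<in> S"
    and A: "A \<subseteq> carrier G"
  shows "card ((g <# A) \<inter> F) + card F \<le> card (A \<inter> F) + card (S <#> F)"
    and "card (A \<inter> F) + card F \<le> card ((g <# A) \<inter> F) + card (S <#> F)"
proof -
  have g: "g \<in> carrier G" using S by blast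
  let ?SF = "S <#> F"
  have fin: "finite ?SF" using F S by (simp add: set_mult_def)
  have inj: "inj_on (\<lambda>x. g \<otimes> x) (carrier G)" using g by (auto intro: inj_onI)
  have gF: "g <# F \<subseteq> ?SF" using S by (auto simp: l_coset_def set_mult_def)
  have FS: "F \<subseteq> ?SF" using S F by (force simp: set_mult_def)
  have card_g: "card (g <# B) = card B" if "B \<subseteq> carrier G" for B
  proof -
    have "g <# B = (\<lambda>x. g \<otimes> x) ` B" by (auto simp: l_coset_def)
    then show ?thesis using card_image[OF inj_on_subset[OF inj that]] by simp
  qed
  have "(g <# A) \<inter> (g <# F) = g <# (A \<inter> F)"
    using A F g by (auto simp: l_coset_def subset_iff)
  then have AF: "card ((g <# A) \<inter> (g <# F)) = card (A \<inter> F)"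
    using card_g[of "A \<inter> F"] A by auto
  have excess: "card (B \<inter> ?SF) + card X \<le> card (B \<inter> X) + card ?SF" if "X \<subseteq> ?SF" for B X
  proof -
    have "card (B \<inter> ?SF) + card X = card (B \<inter> ?SF \<union> X) + card (B \<inter> ?SF \<inter> X)"
      using fin that by (intro card_Un_Int) (auto intro: finite_subset)
    moreover have "card (B \<inter> ?SF \<union> X) \<le> card ?SF" using that fin by (intro card_mono) auto
    moreover have "B \<inter> ?SF \<inter> X = B \<inter> X" using that by blast
    ultimately show ?thesis by simp
  qed
  have "card ((g <# A) \<inter> F) \<le> card ((g <# A) \<inter> ?SF)"
    using FS fin by (intro card_mono) auto
  then show "card ((g <# A) \<inter> F) + card F \<le> card (A \<inter> F) + card ?SF"
    using excess[OF gF, of "g <# A"] AF card_g[OF F(2)] by linarith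
  have "card ((g <# A) \<inter> (g <# F)) \<le> card ((g <# A) \<inter> ?SF)"
    using gF fin by (intro card_mono) auto
  then show "card (A \<inter> F) + card F \<le> card ((g <# A) \<inter> F) + card ?SF"
    using excess[OF FS, of "g <# A"] AF by linarith
qed

text \<open>The normalised counting measures of a Folner sequence are finitely additive and asymptotically
  invariant, so each of their cluster points is an invariant mean.  Countability of the group
  allows a sequence, with \<open>S n\<close> exhausting the group.\<close>

lemma (in group) Folner_imp_amenable:
  assumes cnt: "countable (carrier G)"
    and Folner: "\<And>S n. finite S \<Longrightarrow> S \<subseteq> carrier G \<Longrightarrow> 0 < n \<Longrightarrow>
      \<exists>F. finite F \<and> F \<noteq> {} \<and> F \<subseteq> carrier G \<and> n * card (S <#> F) < Suc n * card F"
  shows "amenable G"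
proof -
  define e where "e = from_nat_into (carrier G)"
  have e: "range e = carrier G" unfolding e_def using cnt by (intro range_from_nat_into) auto
  (* Containing the identity ensures that F is a subset of S F. *)
  define S where "S n = insert \<one> (e ` {..n})" for n
  have S: "finite (S n)" "S n \<subseteq> carrier G" "\<one> \<in> S n" for n
    using e by (auto simp: S_def)
  have "\<forall>n. \<exists>F. finite F \<and> F \<noteq> {} \<and> F \<subseteq> carrier G \<and> Suc n * card (S n <#> F) < Suc (Suc n) * card F"
    using Folner[OF S(1,2)] by blast
  then obtain F where F: "\<And>n. finite (F n)" "\<And>n. F n \<noteq> {}" "\<And>n. F n \<subseteq> carrier G"
    "\<And>n. Suc n * card (S n <#> F n) < Suc (Suc n) * card (F n)"
    by metis
  have pos: "0 < card (F n)" for n using F by (simp add: card_gt_0_iff)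
  define m where "m n A = real (card (A \<inter> F n)) / real (card (F n))" for n A
  have "m n A \<in> {0..1}" for n A
    using pos[of n] F(1) by (simp add: m_def card_mono)
  then obtain \<mu> H where H: "H \<noteq> bot" "H \<le> filtermap m sequentially"
    and \<mu>: "\<And>A. \<mu> A \<in> {0..1}" and lim: "\<And>A. ((\<lambda>f. f A) \<longlongrightarrow> \<mu> A) H"
    by (rule bounded_functions_cluster_point[of m]) blast
  have ev: "eventually P H" if "eventually (\<lambda>n. P (m n)) sequentially" for P
    using that H(2) by (simp add: le_filter_def eventually_filtermap)
  have almost: "\<bar>m n (g <# A) - m n A\<bar> \<le> 1 / real (Suc n)" if "g \<in> S n" "A \<subseteq> carrier G" for n g A
  proof -
    have "real (Suc n) * real (card (S n <#> F n)) \<le> real (Suc (Suc n)) * real (card (F n))"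
      using F(4)[of n] by (metis less_imp_le of_nat_le_iff of_nat_mult)
    then have bound: "real (card (S n <#> F n)) - real (card (F n)) \<le> real (card (F n)) / real (Suc n)"
      by (simp add: field_simps)
    have "\<bar>real (card ((g <# A) \<inter> F n)) - real (card (A \<inter> F n))\<bar> \<le> real (card (F n)) / real (Suc n)"
      using Folner_almost_invariant[OF F(1,3) S that, of n] bound by linarith
    then show ?thesis
      using pos[of n] by (simp add: m_def field_simps flip: diff_divide_distrib)
  qed
  show ?thesis
    unfolding amenable_def
  proof (intro exI[of _ \<mu>] conjI allI impI)
    have "carrier G \<inter> F n = F n" for n using F(3) by blast
    then have "m n (carrier G) = 1" for n using pos[of n] by (simp add: m_def)
    then have "((\<lambda>f. f (carrier G)) \<longlongrightarrow> 1) H"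
      by (intro tendsto_eventually ev) simp
    then show "\<mu> (carrier G) = 1" using tendsto_unique[OF H(1) lim] by blast
    show "0 \<le> \<mu> A" for A using \<mu>[of A] by simp
    show "\<mu> (A \<union> B) = \<mu> A + \<mu> B" if "A \<inter> B = {}" for A B
    proof -
      have "card ((A \<union> B) \<inter> F n) = card (A \<inter> F n) + card (B \<inter> F n)" for n
        using that F(1)[of n] card_Un_disjoint[of "A \<inter> F n" "B \<inter> F n"] by (auto simp: Int_Un_distrib2)
      then have "m n (A \<union> B) = m n A + m n B" for n
        by (simp add: m_def add_divide_distrib)
      then have "((\<lambda>f. f (A \<union> B)) \<longlongrightarrow> \<mu> A + \<mu> B) H"
        by (intro Lim_transform_eventually[OF tendsto_add[OF lim lim]] ev) simp
      then show ?thesis using tendsto_unique[OF H(1) lim] by blast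
    qed
    show "\<mu> (g <# A) = \<mu> A" if g: "g \<in> carrier G" and A: "A \<subseteq> carrier G" for g A
    proof -
      obtain k where k: "g = e k" using g e by blast
      have "\<bar>\<mu> (g <# A) - \<mu> A\<bar> \<le> \<epsilon>" if "0 < \<epsilon>" for \<epsilon> :: real
      proof (rule tendsto_upperbound[OF _ _ H(1)])
        show "((\<lambda>f. \<bar>f (g <# A) - f A\<bar>) \<longlongrightarrow> \<bar>\<mu> (g <# A) - \<mu> A\<bar>) H"
          by (intro tendsto_intros lim)
        obtain N where N: "1 / real (Suc N) < \<epsilon>" using \<open>0 < \<epsilon>\<close> nat_approx_posE by blast
        have "\<bar>m n (g <# A) - m n A\<bar> \<le> \<epsilon>" if "max k N \<le> n" for n
        proof -
          have "g \<in> S n" using that by (simp add: k S_def)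
          moreover have "1 / real (Suc n) \<le> 1 / real (Suc N)"
            using that by (intro divide_left_mono) auto
          ultimately show ?thesis using almost[OF _ A, of g n] N by linarith
        qed
        then show "\<forall>\<^sub>F f in H. \<bar>f (g <# A) - f A\<bar> \<le> \<epsilon>"
          by (intro ev eventually_sequentiallyI[of "max k N"])
      qed
      then have "\<bar>\<mu> (g <# A) - \<mu> A\<bar> \<le> 0" by (rule field_le_epsilon[of _ 0, simplified])
      then show ?thesis by simp
    qed
  qed
qed

text \<open>This criterion quantifies over finite sets only.  That is what turns amenability into a
  countable intersection of open conditions on the multiplication table.\<close>

theorem (in group) amenable_iff_small_doubling:
  assumes "countable (carrier G)"
  shows "amenable G \<longleftrightarrow> (\<forall>S. finite S \<and> S \<subseteq> carrier G \<longrightarrow>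
    (\<exists>F. finite F \<and> F \<noteq> {} \<and> F \<subseteq> carrier G \<and> card (S <#> F) < 2 * card F))"
    (is "_ \<longleftrightarrow> ?D")
proof
  show ?D if "amenable G"
    using amenable_imp_small_doubling[OF that] by simp
  show "amenable G" if small: ?D
  proof (rule Folner_imp_amenable[OF assms])
    fix S :: "'a set" and n :: nat
    assume "finite S" "S \<subseteq> carrier G" "0 < n"
    then show "\<exists>F. finite F \<and> F \<noteq> {} \<and> F \<subseteq> carrier G \<and> n * card (S <#> F) < Suc n * card F"
      using small by (intro small_doubling_imp_Folner) auto
  qed
qed

section \<open>The subspaces of enumerated groups\<close>

lemma locally_constant_enum_mult:
  "x \<in> Npos \<Longrightarrow> y \<in> Npos \<Longrightarrow> locally_constant enum_group_space (\<lambda>p. fst p (x, y))"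
  unfolding enum_group_space_def
  by (intro locally_constant_subtopology locally_constant_structure_mult)

lemma locally_constant_enum_one: "locally_constant enum_group_space (\<lambda>p. snd (snd p))"
  unfolding enum_group_space_def
  by (intro locally_constant_subtopology locally_constant_structure_one)

lemma locally_constant_enum_letter_value:
  assumes "\<And>x. a x \<in> Npos"
  shows "locally_constant enum_group_space (\<lambda>p. letter_value (group_of p) a l)"
proof (cases l)
  case (Pair x b)
  show ?thesis
  proof (cases b)
    case True
    then show ?thesis by (simp add: Pair locally_constant_const)
  next
    case False
    have "locally_constant enum_group_space (\<lambda>p. fst (snd p) (a x))"
      unfolding enum_group_space_def
      by (intro locally_constant_subtopology locally_constant_structure_inv assms)
    then show ?thesis
      by (rule locally_constant_cong[rotated])
         (use False assms in \<open>simp add: Pair topspace_enum_group_space inv_group_of\<close>)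
  qed
qed

lemma locally_constant_enum_word_value:
  assumes a: "\<And>x. a x \<in> Npos"
  shows "locally_constant enum_group_space (\<lambda>p. word_value (group_of p) a w)"
proof (induction w)
  case Nil
  then show ?case
    using locally_constant_enum_one by (simp add: word_value_def group_of_simps)
next
  case (Cons l w)
  have grp: "group (group_of p)" if "p \<in> topspace enum_group_space" for p
    using that group_group_of by (simp add: topspace_enum_group_space)
  have carr: "a x \<in> carrier (group_of p)" for x p
    using a by (simp add: group_of_simps)
  have "letter_value (group_of p) a l \<in> Npos" "word_value (group_of p) a w \<in> Npos"
    if "p \<in> topspace enum_group_space" for p
    using group.letter_value_closed[OF grp[OF that] carr] group.word_value_closed[OF grp[OF that] carr]
    by (simp_all only: group_of_simps)
  then have "locally_constant enum_group_space
      (\<lambda>p. fst p (letter_value (group_of p) a l, word_value (group_of p) a w))"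
    by (intro locally_constant_mult[OF locally_constant_enum_mult] Cons
        locally_constant_enum_letter_value a)
  then show ?case
    by (simp add: word_value_def group_of_simps)
qed

lemma locally_constant_enum_set_mult:
  assumes "finite S" "finite F" "S \<subseteq> Npos" "F \<subseteq> Npos"
  shows "locally_constant enum_group_space (\<lambda>p. S <#>\<^bsub>group_of p\<^esub> F)"
proof -
  have "locally_constant enum_group_space (\<lambda>p. fst p ` (S \<times> F))"
  proof (rule locally_constant_image)
    show "locally_constant enum_group_space (\<lambda>p. fst p z)" if "z \<in> S \<times> F" for z
      using that assms locally_constant_enum_mult[of "fst z" "snd z"] by (cases z) (simp add: subset_iff)
  qed (use assms in simp)
  moreover have "S <#>\<^bsub>group_of p\<^esub> F = fst p ` (S \<times> F)" for p
    by (force simp: set_mult_def group_of_simps)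
  ultimately show ?thesis by simp
qed

text \<open>One closed condition for each assignment of the variables; the uncountable number of assignments
  does no harm to an intersection of closed sets.\<close>

lemma closedin_G_law: "closedin enum_group_space (G_law w)"
proof -
  have "G_law w = {p \<in> topspace enum_group_space. \<forall>a\<in>{a. \<forall>x. a x \<in> Npos}.
      word_value (group_of p) a w = snd (snd p)}"
    unfolding G_law_def obeys_law_def topspace_enum_group_space group_of_simps by simp
  also have "closedin enum_group_space \<dots>"
    by (intro closedin_Collect_Ball closedin_Collect_eq_locally_constant
        locally_constant_enum_word_value locally_constant_enum_one) simp
  finally show ?thesis .
qed

lemma gdelta_G_ll: "gdelta_in enum_group_space G_ll"
proof -
  let ?W = "{w :: nat group_word. freely_reduced w \<and> w \<noteq> []}"
  have "G_ll = {p \<in> topspace enum_group_space. \<forall>w\<in>?W. p \<notin> G_law w}"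
    by (auto simp: G_ll_def G_law_def lawless_def topspace_enum_group_space)
  also have "gdelta_in enum_group_space \<dots>"
  proof (rule gdelta_in_Collect_Ball)
    fix w :: "nat group_word"
    have "openin enum_group_space (topspace enum_group_space - G_law w)"
      using closedin_G_law by blast
    then show "openin enum_group_space {p \<in> topspace enum_group_space. p \<notin> G_law w}"
      by (simp add: set_diff_eq)
  qed simp
  finally show ?thesis .
qed

text \<open>For each of the countably many pairs, the existence of a relation is an open condition: one
  relation is witnessed by finitely many table entries.\<close>

lemma gdelta_G_sm: "gdelta_in enum_group_space G_sm"
proof -
  let ?F = "carrier (free_group {0, 1 :: nat})"
  let ?a = "\<lambda>z n :: nat. if n = 0 then fst z else snd z :: nat"
  have "G_sm = {p \<in> topspace enum_group_space. \<forall>z\<in>Npos \<times> Npos. \<exists>w\<in>?F - {[]}.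
      word_value (group_of p) (?a z) w = snd (snd p)}"
  proof -
    have pairs: "\<not> (\<exists>x\<in>A. \<exists>y\<in>A. \<forall>w\<in>F. w \<noteq> [] \<longrightarrow> \<not> Q x y w) \<longleftrightarrow>
        (\<forall>z\<in>A \<times> A. \<exists>w\<in>F - {[]}. Q (fst z) (snd z) w)"
      for A :: "nat set" and F :: "nat group_word set" and Q
      by (auto simp: Ball_def Bex_def)
    have "\<not> contains_F2 (group_of p) \<longleftrightarrow> (\<forall>z\<in>Npos \<times> Npos. \<exists>w\<in>?F - {[]}.
        word_value (group_of p) (?a z) w = snd (snd p))" if "p \<in> enumerated_groups" for p
      unfolding group.contains_F2_iff[OF group_group_of[OF that]] group_of_simps
      by (rule pairs)
    then show ?thesis by (auto simp: G_sm_def topspace_enum_group_space)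
  qed
  also have "gdelta_in enum_group_space \<dots>"
  proof (intro gdelta_in_Collect_Ball openin_Collect_Bex)
    fix z w assume "z \<in> Npos \<times> Npos"
    then have "locally_constant enum_group_space (\<lambda>p. word_value (group_of p) (?a z) w)"
      by (intro locally_constant_enum_word_value) auto
    then show "openin enum_group_space {p \<in> topspace enum_group_space.
        word_value (group_of p) (?a z) w = snd (snd p)}"
      using openin_Collect_locally_constant[OF
          locally_constant_compose2[OF _ locally_constant_enum_one, where h = "(=)"], where P = "\<lambda>b. b"]
      by blast
  qed simp
  finally show ?thesis .
qed

text \<open>For finite \<open>S\<close> and \<open>F\<close> the product set depends on finitely many table entries, so the existence
  of a suitable \<open>F\<close> is an open condition; there are countably many \<open>S\<close>.\<close>

lemma gdelta_G_am: "gdelta_in enum_group_space G_am"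
proof -
  let ?Fin = "{S. S \<subseteq> Npos \<and> finite S}"
  have "G_am = {p \<in> topspace enum_group_space. \<forall>S\<in>?Fin. \<exists>F\<in>?Fin - {{}}.
      card (S <#>\<^bsub>group_of p\<^esub> F) < 2 * card F}"
  proof -
    have "amenable (group_of p) \<longleftrightarrow> (\<forall>S\<in>?Fin. \<exists>F\<in>?Fin - {{}}.
        card (S <#>\<^bsub>group_of p\<^esub> F) < 2 * card F)" if "p \<in> enumerated_groups" for p
    proof -
      have "countable (carrier (group_of p))" by simp
      note * = group.amenable_iff_small_doubling[OF group_group_of[OF that] this]
      have bounded: "(\<forall>S. finite S \<and> S \<subseteq> A \<longrightarrow> (\<exists>F. finite F \<and> F \<noteq> {} \<and> F \<subseteq> A \<and> Q S F)) \<longleftrightarrow>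
          (\<forall>S\<in>{S. S \<subseteq> A \<and> finite S}. \<exists>F\<in>{S. S \<subseteq> A \<and> finite S} - {{}}. Q S F)"
        for A :: "nat set" and Q
        by (simp add: Ball_def Bex_def conj_ac)
      show ?thesis unfolding * group_of_simps by (rule bounded)
    qed
    then show ?thesis by (auto simp: G_am_def topspace_enum_group_space)
  qed
  also have "gdelta_in enum_group_space \<dots>"
  proof (intro gdelta_in_Collect_Ball openin_Collect_Bex)
    show "countable ?Fin"
      using countable_Collect_finite_subset[of Npos] by (simp add: conj_commute)
    fix S F assume "S \<in> ?Fin" "F \<in> ?Fin - {{}}"
    then have "locally_constant enum_group_space (\<lambda>p. S <#>\<^bsub>group_of p\<^esub> F)"
      by (intro locally_constant_enum_set_mult) auto
    then show "openin enum_group_space {p \<in> topspace enum_group_space.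
        card (S <#>\<^bsub>group_of p\<^esub> F) < 2 * card F}"
      by (rule openin_Collect_locally_constant)
  qed
  finally show ?thesis .
qed

theorem theorem3p4p1:
  fixes w :: "nat group_word"
  shows "(\<forall>S \<in> {G_sm, G_am, G_ll, G_sm \<inter> G_ll, G_am \<inter> G_ll, G_law w, G_am \<inter> G_law w}.
            gdelta_in enum_group_space S \<and> polish (subtopology enum_group_space S))
         \<and> closedin enum_group_space (G_law w)"
proof -
  have "gdelta_in enum_group_space (G_law w)"
    using closed_imp_gdelta_in closedin_G_law completely_metrizable_enum_group_space
      completely_metrizable_imp_metrizable_space by blast
  then have "gdelta_in enum_group_space S"
    if "S \<in> {G_sm, G_am, G_ll, G_sm \<inter> G_ll, G_am \<inter> G_ll, G_law w, G_am \<inter> G_law w}" for S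
    using that gdelta_G_sm gdelta_G_am gdelta_G_ll by (auto intro: gdelta_in_Int)
  then show ?thesis
    using polish_gdelta_in[OF completely_metrizable_enum_group_space second_countable_enum_group_space]
      closedin_G_law by blast
qed

end
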